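(* Let $q$ be an odd prime. Let $p$ be a prime such that $p\equiv 3 \pmod 4$ and $p\equiv 1 \pmod q$. For $k=1,\dots,q$ put $$\Pi_{k}^{(q)}=\prod_{j=(k-1)(p-1)/q+1}^{k(p-1)/q}j .$$ Then the integer $$\prod_{\substack{1\le k\le (q-1)/2\\ (q+1)/2 -k \equiv 1 \bmod 2}}\Pi_{k}^{(q)}$$ is a quadratic residue modulo $p$.
   Context: Quadratic residue modulo $p$ means a nonzero square in $\mathbb{Z}/p\mathbb{Z}$. Since $p\equiv 1 \pmod q$, the number $(p-1)/q$ is an integer, so the products $\Pi_k^{(q)}$ are over consecutive blocks of $(p-1)/q$ integers in $\{1,\dots,p-1\}$. *)

theory Defs
  imports "HOL-Number_Theory.Number_Theory"
begin

(* Used only with q dvd p - 1 and k \<ge> 1, so that neither the division nor the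
   subtractions truncate. *)
definition block_prod :: "nat \<Rightarrow> nat \<Rightarrow> nat \<Rightarrow> nat" where
  "block_prod p q k = (\<Prod>j = (k - 1) * (p - 1) div q + 1 .. k * (p - 1) div q. j)"

(* The library's QuadRes also holds for multiples of the modulus, which are excluded here. *)
definition nonzero_quad_res :: "int \<Rightarrow> int \<Rightarrow> bool" where
  "nonzero_quad_res p a \<longleftrightarrow> \<not> [a = 0] (mod p) \<and> QuadRes p a"

end

(* Write q = 2 l + 1, p = q m + 1, let chi be the Legendre symbol modulo p and T_k the sum of
   chi over the k-th block, blocks being numbered from 0. On block k, q j mod p = q j - k p, so
   comparing the sum H of j chi(j) with its rearrangement under j -> q j mod p, and using
   T_(2l-k) = -T_k (as chi is odd), gives p W = (chi(q) - q) / 2 * H for W = sum_(k<l) (l-k) T_k.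
   Here H is odd, and chi(q) = (-1)^l by quadratic reciprocity, so W is determined modulo 4.
   On the other hand, modulo 4, T_k = m + c_k - 1 where c_k is the symbol of the product of block k,
   and hence W = m * sum_(k<l) (l-k) + prod_(k<l) c_k^(l-k) - 1. Since m = 2 modulo 4, comparing both
   values of W yields prod_(k<l) c_k^(l-k) = 1; only the factors with l - k odd matter. *)

theory Submission
  imports Defs
begin

section \<open>Values and multiplicativity of the Legendre symbol\<close>

text \<open>Euler's criterion makes both sides congruent modulo \<open>p\<close>. They lie in {-1,
  0, 1}, so they differ by at most 2 < \<open>p\<close> and must agree.\<close>

lemma Legendre_mult:
  assumes "prime p" "2 < p"
  shows "Legendre (a * b) (int p) = Legendre a p * Legendre b p"
proof -
  have "[Legendre (a * b) p = (a * b) ^ ((p - 1) div 2)] (mod p)"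
    using euler_criterion assms by blast
  also have "(a * b) ^ ((p - 1) div 2) = a ^ ((p - 1) div 2) * b ^ ((p - 1) div 2)"
    by (rule power_mult_distrib)
  also have "[\<dots> = Legendre a p * Legendre b p] (mod p)"
    by (intro cong_mult euler_criterion[THEN cong_sym] assms)
  finally have "int p dvd Legendre (a * b) p - Legendre a p * Legendre b p"
    by (simp add: cong_iff_dvd_diff)
  moreover have "\<bar>Legendre (a * b) p - Legendre a p * Legendre b p\<bar> < int p"
    using assms(2) by (auto simp: Legendre_def)
  ultimately show ?thesis
    using zdvd_not_zless[of "\<bar>Legendre (a * b) p - Legendre a p * Legendre b p\<bar>" "int p"] by force
qed

lemma Legendre_cong: "[a = b] (mod p) \<Longrightarrow> Legendre a p = Legendre b p"
  by (simp add: Legendre_def QuadRes_def cong_def)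

lemma Legendre_minus_one:
  assumes "prime p" "[p = 3] (mod 4)"
  shows "Legendre (- 1) (int p) = - 1"
proof -
  have "p mod 4 = 3" using assms(2) by (simp add: cong_def)
  then have p: "2 < p" "odd ((p - 1) div 2)" by presburger+
  then have "[Legendre (- 1) p = - 1] (mod p)"
    using euler_criterion[OF assms(1) p(1), of "- 1"] by simp
  then have "int p dvd Legendre (- 1) p + 1" by (simp add: cong_iff_dvd_diff)
  then show ?thesis
    using p(1) by (auto simp: Legendre_def split: if_splits dest: zdvd_imp_le)
qed

lemma Legendre_prod:
  assumes "prime p" "2 < p"
  shows "Legendre (\<Prod>x\<in>A. f x) (int p) = (\<Prod>x\<in>A. Legendre (f x) p)"
proof -
  have "Legendre 1 (int p) = 1"
  proof -
    have "QuadRes (int p) 1" unfolding QuadRes_def by (rule exI[of _ 1]) simp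
    then show ?thesis using assms(2) by (simp add: Legendre_def cong_def)
  qed
  then show ?thesis
    by (induction A rule: infinite_finite_induct) (simp_all add: Legendre_mult[OF assms])
qed

lemma Legendre_cases:
  assumes "1 \<le> j" "j < p"
  shows "Legendre (int j) (int p) = 1 \<or> Legendre (int j) (int p) = - 1"
proof -
  have "\<not> [int j = 0] (mod int p)"
    using assms by (auto simp: cong_0_iff dest: zdvd_imp_le)
  then show ?thesis by (simp add: Legendre_def)
qed

section \<open>Weighted sums of signs modulo 4\<close>

lemma prod_pm1_power:
  fixes c :: "'a \<Rightarrow> int"
  assumes "\<And>x. x \<in> A \<Longrightarrow> c x = 1 \<or> c x = - 1"
  shows "(\<Prod>x\<in>A. c x ^ d x) = 1 \<or> (\<Prod>x\<in>A. c x ^ d x) = - 1"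
  using assms
proof (induction A rule: infinite_finite_induct)
  case (insert x F)
  then have "c x ^ d x = 1 \<or> c x ^ d x = - 1"
    by (metis insertI1 minus_one_power_iff power_one)
  then show ?case using insert by auto
qed auto

text \<open>This turns sums of signs into products. It serves twice: with weights 1 inside a block,
  and with weights \<open>l - k\<close> across the blocks.\<close>

lemma weighted_sum_pm1_cong:
  fixes c :: "'a \<Rightarrow> int"
  assumes "finite A" "\<And>x. x \<in> A \<Longrightarrow> c x = 1 \<or> c x = - 1"
  shows "[(\<Sum>x\<in>A. int (d x) * c x) = (\<Sum>x\<in>A. int (d x)) + (\<Prod>x\<in>A. c x ^ d x) - 1] (mod 4)"
  using assms
proof (induction A)
  case (insert x F)
  let ?P = "\<Prod>x\<in>F. c x ^ d x"
  have P: "?P = 1 \<or> ?P = - 1" using prod_pm1_power insert.prems by (metis insertCI)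
  have IH: "4 dvd (\<Sum>x\<in>F. int (d x) * c x) - ((\<Sum>x\<in>F. int (d x)) + ?P - 1)"
    using insert by (simp add: cong_iff_dvd_diff)
  have c: "c x = 1 \<or> c x = - 1" using insert by simp
  \<comment> \<open>For \<open>c x = - 1\<close> the expression is -2d if d = \<open>d x\<close> is
    even, and 2(\<open>?P\<close> - d) with \<open>?P\<close> and d both odd otherwise.\<close>
  have "4 dvd int (d x) * c x - int (d x) + ?P - c x ^ d x * ?P"
    using c
  proof
    assume "c x = - 1"
    then show ?thesis using P by (cases "even (d x)") (auto elim!: evenE oddE)
  qed simp
  from dvd_add[OF IH this] show ?case
    using insert.hyps by (simp add: cong_iff_dvd_diff algebra_simps)
qed simp

section \<open>Rearranging and folding sums\<close>

text \<open>Multiplication by a unit permutes the nonzero residues.\<close>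

lemma sum_mult_mod:
  fixes a p :: nat
  assumes "coprime a p"
  shows "(\<Sum>j=1..<p. f (a * j mod p)) = (\<Sum>j=1..<p. f j)"
proof -
  let ?g = "\<lambda>j. a * j mod p"
  have "?g j \<in> {1..<p}" if "j \<in> {1..<p}" for j
  proof -
    have "\<not> p dvd j" using that by (auto dest: dvd_imp_le)
    then have "\<not> p dvd a * j"
      using assms by (simp add: coprime_dvd_mult_right_iff coprime_commute)
    with that show ?thesis by (simp add: Suc_le_eq mod_greater_zero_iff_not_dvd)
  qed
  then have "?g ` {1..<p} \<subseteq> {1..<p}" by blast
  moreover have "inj_on ?g {1..<p}"
  proof (rule inj_onI)
    fix i j assume ij: "i \<in> {1..<p}" "j \<in> {1..<p}" and "?g i = ?g j"
    then have "[a * i = a * j] (mod p)" by (simp add: cong_def)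
    then have "[i = j] (mod p)" using assms by (simp add: cong_mult_lcancel_nat)
    then show "i = j" using ij by (simp add: cong_def)
  qed
  ultimately have "bij_betw ?g {1..<p} {1..<p}"
    by (simp add: bij_betw_def endo_inj_surj)
  then show ?thesis by (rule sum.reindex_bij_betw)
qed

lemma sum_symmetric:
  fixes f :: "nat \<Rightarrow> 'a::comm_semiring_1"
  assumes "\<And>k. k < l \<Longrightarrow> f (2 * l - k) = f k"
  shows "(\<Sum>k<2 * l + 1. f k) = f l + 2 * (\<Sum>k<l. f k)"
proof -
  have "f (2 * l - k) = f k" if "k \<in> {l<..<2 * l + 1}" for k
    using assms[of "2 * l - k"] that by auto
  then have "(\<Sum>k\<in>{l<..<2 * l + 1}. f k) = (\<Sum>k<l. f k)"
    by (intro sum.reindex_bij_witness[of _ "\<lambda>k. 2 * l - k" "\<lambda>k. 2 * l - k"]) auto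
  moreover have "{..<2 * l + 1} = insert l ({..<l} \<union> {l<..<2 * l + 1})" by auto
  moreover have "(\<Sum>k\<in>{..<l} \<union> {l<..<2 * l + 1}. f k)
      = (\<Sum>k<l. f k) + (\<Sum>k\<in>{l<..<2 * l + 1}. f k)"
    by (rule sum.union_disjoint) auto
  ultimately show ?thesis by (simp add: mult_2)
qed

section \<open>The identity for the weighted block sums\<close>

lemma Legendre_block_sum_identity:
  fixes p l m :: nat and T :: "nat \<Rightarrow> int"
  assumes p: "prime p" "[p = 3] (mod 4)" and pm: "p = (2 * l + 1) * m + 1"
    and T_def: "\<And>k. T k = (\<Sum>i\<in>{k * m..<k * m + m}. Legendre (int (i + 1)) p)"
  shows "2 * int p * (\<Sum>k<l. int (l - k) * T k)
    = (Legendre (int (2 * l + 1)) p - int (2 * l + 1)) * (\<Sum>j=1..<p. int j * Legendre (int j) p)"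
    (is "_ = (?e - _) * ?H")
proof -
  define q where "q = 2 * l + 1"
  define \<chi> where "\<chi> = (\<lambda>j. Legendre (int j) (int p))"
  have pq: "p = q * m + 1" using pm by (simp add: q_def)
  have "p mod 4 = 3" using p(2) by (simp add: cong_def)
  then have p2: "2 < p" by presburger
  have m: "0 < m" using p2 pq by (cases m) auto
  have "q < p"
  proof -
    have "q * 1 \<le> q * m" using m by (intro mult_le_mono2) auto
    with pq show ?thesis by linarith
  qed
  have coprime: "coprime q p"
    unfolding pq by (metis coprime_commute coprime_mult_left_iff coprime_Suc_left_nat Suc_eq_plus1)
  have q1: "1 \<le> q" by (simp add: q_def)
  have e: "\<chi> q * \<chi> q = 1"
    using Legendre_cases[OF q1 \<open>q < p\<close>] by (auto simp: \<chi>_def)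
  have \<chi>_mod: "\<chi> (j mod p) = \<chi> j" for j
    unfolding \<chi>_def by (rule Legendre_cong) (simp add: cong_def zmod_int)
  have \<chi>_mult: "\<chi> (i * j) = \<chi> i * \<chi> j" for i j
    unfolding \<chi>_def by (simp add: Legendre_mult[OF p(1) p2])
  have \<chi>_minus: "\<chi> (p - j) = - \<chi> j" if "j \<le> p" for j
  proof -
    have "[int (p - j) = - 1 * int j] (mod int p)"
      using that by (simp add: cong_iff_dvd_diff of_nat_diff)
    from Legendre_cong[OF this] show ?thesis
      by (simp add: \<chi>_def Legendre_mult[OF p(1) p2] Legendre_minus_one[OF p]
          del: mult_minus1 mult_minus_left)
  qed
  have blocks: "(\<Sum>j=1..<p. f j) = (\<Sum>k<q. \<Sum>i\<in>{k * m..<k * m + m}. f (i + 1))"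
    for f :: "nat \<Rightarrow> int"
  proof -
    have "(\<Sum>j=1..<p. f j) = (\<Sum>i<q * m. f (i + 1))"
      by (rule sum.reindex_bij_witness[of _ Suc "\<lambda>j. j - 1"]) (auto simp: pq)
    also have "\<dots> = (\<Sum>k<q. \<Sum>i\<in>{k * m..<k * m + m}. f (i + 1))"
      by (rule sum.nat_group[symmetric])
    finally show ?thesis .
  qed
  \<comment> \<open>With i = k m + r and r < m, q (i + 1) = k p + (q (r + 1) - k). Since k < q the
    subtraction does not truncate, and the remainder is at most q m < p.\<close>
  have mod_block: "int (q * (i + 1) mod p) = int q * int (i + 1) - int p * int k"
    if k: "k < q" and i: "i \<in> {k * m..<k * m + m}" for k i
  proof -
    obtain r where r: "i = k * m + r" "r < m"
      using i by (metis atLeastLessThan_iff le_Suc_ex nat_add_left_cancel_less)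
    have "q * r + q \<le> q * m"
      using r(2) by (metis Suc_leI mult_le_mono2 mult_Suc_right add.commute)
    then have "q * (r + 1) - k < p" using pq by simp
    moreover have split: "q * (i + 1) = k * p + (q * (r + 1) - k)"
      using k by (simp add: r pq algebra_simps)
    ultimately have "q * (i + 1) mod p = q * (r + 1) - k" by simp
    moreover have "int q * int (i + 1) = int k * int p + int (q * (r + 1) - k)"
      using split by (metis of_nat_add of_nat_mult)
    ultimately show ?thesis by (simp add: mult.commute)
  qed
  \<comment> \<open>Rearranging \<open>?H\<close> by j -> q j mod p produces a second factor
    \<open>\<chi> q\<close>, which cancels the one in front.\<close>
  have "\<chi> q * ?H = \<chi> q * (\<Sum>j=1..<p. int (q * j mod p) * \<chi> (q * j mod p))"
    by (subst sum_mult_mod[OF coprime, of "\<lambda>j. int j * \<chi> j"]) (simp add: \<chi>_def)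
  also have "\<dots> = (\<Sum>j=1..<p. int (q * j mod p) * \<chi> j * (\<chi> q * \<chi> q))"
    by (simp add: \<chi>_mod \<chi>_mult sum_distrib_left mult_ac)
  also have "\<dots> = (\<Sum>j=1..<p. int (q * j mod p) * \<chi> j)" by (simp add: e)
  also have "\<dots> = (\<Sum>k<q. \<Sum>i\<in>{k * m..<k * m + m}. (int q * int (i + 1) - int p * int k) * \<chi> (i + 1))"
    unfolding blocks by (intro sum.cong refl) (simp only: mod_block lessThan_iff)
  also have "\<dots> = int q * ?H - int p * (\<Sum>k<q. int k * T k)"
    unfolding blocks
    by (simp add: T_def \<chi>_def left_diff_distrib sum_subtractf sum_distrib_left mult.assoc)
  finally have eH: "\<chi> q * ?H = int q * ?H - int p * (\<Sum>k<q. int k * T k)" .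
  have T_\<chi>: "T k = (\<Sum>i\<in>{k * m..<k * m + m}. \<chi> (i + 1))" for k
    by (simp add: T_def \<chi>_def)
  \<comment> \<open>The reflection j -> p - j exchanges blocks k and 2 l - k. For the shifted index
    i = j - 1 it reads i -> q m - 1 - i.\<close>
  have T_minus: "T (2 * l - k) = - T k" if "k \<le> 2 * l" for k
  proof -
    have qk: "(2 * l - k) * m + m + k * m = q * m"
      using that by (simp add: q_def flip: add_mult_distrib)
    have "T (2 * l - k) = (\<Sum>i\<in>{k * m..<k * m + m}. \<chi> (p - (i + 1)))"
      unfolding T_\<chi>
      by (rule sum.reindex_bij_witness[of _ "\<lambda>i. q * m - Suc i" "\<lambda>i. q * m - Suc i"])
        (use qk pq in \<open>auto simp: Suc_diff_Suc\<close>)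
    also have "\<dots> = (\<Sum>i\<in>{k * m..<k * m + m}. - \<chi> (i + 1))"
      by (intro sum.cong refl \<chi>_minus) (use qk pq in auto)
    finally show ?thesis by (simp add: T_\<chi> sum_negf)
  qed
  have "(\<Sum>k<q. T k) = (\<Sum>k<q. T (2 * l - k))"
    by (subst sum.nat_diff_reindex[symmetric]) (simp add: q_def)
  also have "\<dots> = - (\<Sum>k<q. T k)"
    by (simp add: T_minus q_def sum_negf del: sum.lessThan_Suc)
  finally have T0: "(\<Sum>k<q. T k) = 0" by simp
  \<comment> \<open>Because the \<open>T k\<close> sum to zero, the weight -k may be replaced by l -
    k. This weight is odd under k -> 2 l - k, like \<open>T\<close>, so the terms pair up and the
    middle one vanishes.\<close>
  have "- (\<Sum>k<q. int k * T k) = (\<Sum>k<q. (int l - int k) * T k)"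
    using T0 by (simp add: left_diff_distrib sum_subtractf flip: sum_distrib_left)
  also have "\<dots> = 2 * (\<Sum>k<l. (int l - int k) * T k)"
    unfolding q_def by (subst sum_symmetric) (auto simp: T_minus of_nat_diff left_diff_distrib)
  also have "(\<Sum>k<l. (int l - int k) * T k) = (\<Sum>k<l. int (l - k) * T k)"
    by (intro sum.cong refl) (simp add: of_nat_diff)
  finally have "(\<Sum>k<q. int k * T k) = - 2 * (\<Sum>k<l. int (l - k) * T k)" by simp
  with eH have "\<chi> q * ?H = int q * ?H + 2 * int p * (\<Sum>k<l. int (l - k) * T k)" by simp
  then show ?thesis by (simp only: \<chi>_def q_def left_diff_distrib)
qed

section \<open>Arithmetic modulo 4\<close>

lemma double_sum_int_diff: "(\<Sum>k<l. int (l - k)) * 2 = int l * (int l + 1)"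
proof -
  have "(\<Sum>k<l. int (l - k)) = (\<Sum>k<l. int (k + 1))"
    by (subst sum.nat_diff_reindex[symmetric]) (auto intro!: sum.cong)
  also have "\<dots> * 2 = int l * (int l + 1)" by (induction l) (auto simp: algebra_simps)
  finally show ?thesis .
qed

(* The hypothesis on t, l and e says that t = (l + 1) div 2 and e = (-1)^l. *)
lemma mod_4_arithmetic:
  fixes W H D t p m l e :: int
  assumes "[p = 3] (mod 4)" "[m = 2] (mod 4)" "odd H"
    and t: "l = 2 * t \<and> e = 1 \<or> l = 2 * t - 1 \<and> e = - 1"
    and D: "D * 2 = l * (l + 1)"
    and W: "2 * p * W = (e - (2 * l + 1)) * H"
  shows "[W = m * D] (mod 4)"
proof -
  obtain a where "p - 3 = 4 * a"
    using assms(1) unfolding cong_iff_dvd_diff by (rule dvdE)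
  then have a: "p = 4 * a + 3" by simp
  obtain c where "m - 2 = 4 * c"
    using assms(2) unfolding cong_iff_dvd_diff by (rule dvdE)
  then have c: "m = 4 * c + 2" by simp
  obtain b where b: "H = 2 * b + 1" using assms(3) by (rule oddE)
  \<comment> \<open>In both cases of \<open>t\<close>, e - (2 l + 1) = -4 t.\<close>
  have "2 * (p * W) = 2 * (- 2 * t * H)" using W t by auto
  then have "p * W = - 2 * t * H" by linarith
  \<comment> \<open>Modulo 4, p is -1 and 2 t H is 2 t, so W is 2 t. It remains to see that m D,
    which is 2 D = l (l + 1) modulo 4, is 2 t as well.\<close>
  then have 1: "W - 2 * t = 4 * (a * W + W + t * b)" by (simp add: a b algebra_simps)
  have 2: "4 dvd l * (l + 1) - 2 * t"
    using t
  proof (elim disjE conjE)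
    assume l: "l = 2 * t"
    have "l * (l + 1) - 2 * t = 4 * (t * t)" unfolding l by (simp add: algebra_simps)
    then show ?thesis by (metis dvd_triv_left)
  next
    assume l: "l = 2 * t - 1"
    have "l * (l + 1) - 2 * t = 4 * (t * t - t)" unfolding l by (simp add: algebra_simps)
    then show ?thesis by (metis dvd_triv_left)
  qed
  have "m * D = 4 * (c * D) + D * 2" by (simp add: c algebra_simps)
  then have "W - m * D = 4 * (a * W + W + t * b - c * D) - (l * (l + 1) - 2 * t)"
    using 1 unfolding D by (simp add: right_diff_distrib)
  then show ?thesis by (simp only: cong_iff_dvd_diff dvd_diff 2 dvd_triv_left)
qed

section \<open>Comparison of the two values of the weighted sum\<close>

theorem theorem1:
  fixes p q :: nat
  assumes "prime q" and "odd q"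
    and "prime p" and "[p = 3] (mod 4)" and "[p = 1] (mod q)"
  shows "nonzero_quad_res (int p)
    (int (\<Prod>k | 1 \<le> k \<and> k \<le> (q - 1) div 2 \<and> [(q + 1) div 2 - k = 1] (mod 2).
            block_prod p q k))"
proof -
  obtain l where l: "q = 2 * l + 1" using \<open>odd q\<close> by (rule oddE)
  have "l > 0" using \<open>prime q\<close> l by (cases l) auto
  have p4: "p mod 4 = 3" using \<open>[p = 3] (mod 4)\<close> by (simp add: cong_def)
  then have p2: "2 < p" by presburger
  have "q dvd p - 1" using \<open>[p = 1] (mod q)\<close> p2 by (simp add: cong_altdef_nat)
  then obtain m where "p - 1 = q * m" by (rule dvdE)
  then have pm: "p = q * m + 1" using p2 by linarith
  \<comment> \<open>As p is odd and q is odd, m = 2 n. Then p = 2 n + 1 modulo 4, which forces n to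
    be odd.\<close>
  have "m mod 4 = 2"
  proof -
    have "odd p" using p4 by presburger
    then obtain n where n: "m = 2 * n" using pm \<open>odd q\<close> by (auto elim: evenE)
    then have "p = 4 * (l * n) + 2 * n + 1" by (simp add: pm l)
    then show ?thesis using p4 n by presburger
  qed
  have "q < p"
  proof -
    have "q * 1 \<le> q * m" using \<open>m mod 4 = 2\<close> by (intro mult_le_mono2) (cases m; simp)
    with pm show ?thesis by linarith
  qed
  define \<chi> where "\<chi> = (\<lambda>j. Legendre (int j) (int p))"
  define T where "T k = (\<Sum>i\<in>{k * m..<k * m + m}. \<chi> (i + 1))" for k
  define c where "c k = (\<Prod>i\<in>{k * m..<k * m + m}. \<chi> (i + 1))" for k
  define H where "H = (\<Sum>j=1..<p. int j * \<chi> j)"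
  define W where "W = (\<Sum>k<l. int (l - k) * T k)"
  define D where "D = (\<Sum>k<l. int (l - k))"
  have block: "(k + 1) * m \<le> q * m" if "k < l" for k
    using that l by (intro mult_le_mono1) simp
  have \<chi>_cases: "\<chi> (i + 1) = 1 \<or> \<chi> (i + 1) = - 1"
    if "k < l" "i \<in> {k * m..<k * m + m}" for i k
    unfolding \<chi>_def by (rule Legendre_cases) (use that block[of k] pm in auto)
  have c_cases: "c k = 1 \<or> c k = - 1" if "k < l" for k
    using prod_pm1_power[of "{k * m..<k * m + m}" "\<lambda>i. \<chi> (i + 1)" "\<lambda>_. 1", OF \<chi>_cases[OF that]]
    by (simp add: c_def)
  have T_cong: "[T k = int m + c k - 1] (mod 4)" if "k < l" for k
    using weighted_sum_pm1_cong[of "{k * m..<k * m + m}" "\<lambda>i. \<chi> (i + 1)" "\<lambda>_. 1", OF _ \<chi>_cases[OF that]]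
    by (simp add: T_def c_def)

  have W: "2 * int p * W = (\<chi> q - int q) * H"
    using Legendre_block_sum_identity[OF \<open>prime p\<close> \<open>[p = 3] (mod 4)\<close>, of l m T]
    by (simp add: W_def H_def T_def \<chi>_def pm l)
  \<comment> \<open>Since p is 1 modulo q, the reciprocal symbol is 1. The exponent (p - 1)/2 * l
    has the parity of l because (p - 1)/2 is odd.\<close>
  have e: "\<chi> q = (- 1) ^ l"
  proof -
    have "[int p = 1] (mod int q)" using \<open>[p = 1] (mod q)\<close> by (metis cong_int_iff of_nat_1)
    then have "Legendre (int p) (int q) = Legendre 1 (int q)" by (rule Legendre_cong)
    also have "\<dots> = 1"
      \<comment> \<open>The empty product yields the symbol of 1.\<close>
      using Legendre_prod[OF \<open>prime q\<close>, of "\<lambda>_. 1" "{}"] \<open>l > 0\<close> l by simp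
    finally have "\<chi> q = (- 1) ^ ((p - 1) div 2 * ((q - 1) div 2))"
      using Quadratic_Reciprocity[OF \<open>prime p\<close> p2 \<open>prime q\<close>] \<open>q < p\<close> \<open>l > 0\<close> l
      by (simp add: \<chi>_def)
    moreover have "odd ((p - 1) div 2)" using p4 by presburger
    ultimately show ?thesis by (simp add: l power_mult)
  qed
  \<comment> \<open>Each \<open>\<chi> j\<close> is odd, so H has the parity of 1 + ... + (p - 1) =
    p (p - 1)/2, which is odd for p = 3 modulo 4.\<close>
  have "odd H"
  proof -
    have "even (\<Sum>j\<in>A. int j * \<chi> j - int j)" if "A \<subseteq> {1..<p}" for A
    proof (rule dvd_sum)
      fix j assume "j \<in> A"
      then have "\<chi> j = 1 \<or> \<chi> j = - 1"
        unfolding \<chi>_def by (intro Legendre_cases) (use that in auto)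
      then show "even (int j * \<chi> j - int j)" by auto
    qed
    from this[of "{1..<p}"] have "even (H - (\<Sum>j=1..<p. int j))"
      by (simp add: H_def sum_subtractf)
    moreover have "odd (\<Sum>j=1..<p. int j)"
    proof -
      obtain n where n: "p = 4 * n + 3" using p4 by (metis mult_div_mod_eq)
      have "2 * (\<Sum>j=1..<p. j) = p * (p - 1)"
        by (induction p) (auto simp: algebra_simps)
      then have "(\<Sum>j=1..<p. j) = p * (2 * n + 1)" by (simp add: n algebra_simps)
      then show ?thesis by (simp add: n flip: of_nat_sum)
    qed
    ultimately show ?thesis by simp
  qed
  have "[W = int m * D] (mod 4)"
  proof (rule mod_4_arithmetic)
    show "[int p = 3] (mod 4)" using cong_int_iff[of p 3 4] p4 by (simp add: cong_def)
    show "[int m = 2] (mod 4)"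
      using cong_int_iff[of m 2 4] \<open>m mod 4 = 2\<close> by (simp add: cong_def)
    show "D * 2 = int l * (int l + 1)" unfolding D_def by (rule double_sum_int_diff)
    show "2 * int p * W = (\<chi> q - (2 * int l + 1)) * H" using W by (simp add: l)
    show "int l = 2 * int ((l + 1) div 2) \<and> \<chi> q = 1
        \<or> int l = 2 * int ((l + 1) div 2) - 1 \<and> \<chi> q = - 1"
      unfolding e by (cases "even l") (auto elim!: evenE oddE)
  qed fact
  moreover have "[W = int m * D + (\<Prod>k<l. c k ^ (l - k)) - 1] (mod 4)"
  proof -
    have "[W = (\<Sum>k<l. int (l - k) * (int m + c k - 1))] (mod 4)"
      unfolding W_def by (intro cong_sum cong_mult cong_refl T_cong) simp
    also have "(\<Sum>k<l. int (l - k) * (int m + c k - 1)) = int m * D - D + (\<Sum>k<l. int (l - k) * c k)"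
      by (simp add: D_def algebra_simps sum.distrib sum_subtractf sum_distrib_left)
    also have "[\<dots> = int m * D - D + (D + (\<Prod>k<l. c k ^ (l - k)) - 1)] (mod 4)"
      unfolding D_def by (intro cong_add cong_refl weighted_sum_pm1_cong) (use c_cases in auto)
    finally show ?thesis by (simp add: add_diff_eq)
  qed
  ultimately have "[int m * D + (\<Prod>k<l. c k ^ (l - k)) - 1 = int m * D] (mod 4)"
    by (rule cong_trans[OF cong_sym, rotated])
  then have "[(\<Prod>k<l. c k ^ (l - k)) = 1] (mod 4)"
    by (simp add: cong_iff_dvd_diff algebra_simps)
  moreover have "(\<Prod>k<l. c k ^ (l - k)) = 1 \<or> (\<Prod>k<l. c k ^ (l - k)) = - 1"
    by (rule prod_pm1_power) (use c_cases in auto)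
  ultimately have prod1: "(\<Prod>k<l. c k ^ (l - k)) = 1"
    by (auto simp: cong_def)

  let ?A = "{k. 1 \<le> k \<and> k \<le> (q - 1) div 2 \<and> [(q + 1) div 2 - k = 1] (mod 2)}"
  \<comment> \<open>Here k still counts from 1. Passing to \<open>k - 1\<close> below turns
    \<open>l + 1 - k\<close> into the exponent \<open>l - k\<close> of the blocks counted from
    0.\<close>
  have A: "?A = {k. 1 \<le> k \<and> k \<le> l \<and> odd (l + 1 - k)}"
  proof -
    have "[n = 1] (mod 2) \<longleftrightarrow> odd n" for n :: nat
      by (simp add: cong_def odd_iff_mod_2_eq_one)
    then show ?thesis by (simp add: l)
  qed
  have Legendre_block: "Legendre (int (block_prod p q (k + 1))) p = c k" for k
  proof -
    have block_end: "n * (p - 1) div q = n * m" for n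
    proof -
      have "n * (p - 1) = n * m * q" by (simp add: pm)
      then show ?thesis using l by (simp only: nonzero_mult_div_cancel_right)
    qed
    have "block_prod p q (k + 1) = (\<Prod>j=k * m + 1..k * m + m. j)"
      unfolding block_prod_def block_end by (simp add: add.commute)
    also have "\<dots> = (\<Prod>i\<in>{k * m..<k * m + m}. i + 1)"
      by (rule prod.reindex_bij_witness[of _ Suc "\<lambda>j. j - 1"]) auto
    finally show ?thesis
      by (simp add: Legendre_prod[OF \<open>prime p\<close> p2] c_def \<chi>_def)
  qed
  have "Legendre (int (\<Prod>k\<in>?A. block_prod p q k)) p = (\<Prod>k\<in>?A. Legendre (int (block_prod p q k)) p)"
    by (simp add: Legendre_prod[OF \<open>prime p\<close> p2])
  also have "\<dots> = (\<Prod>k\<in>{k \<in> {..<l}. odd (l - k)}. c k)"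
    unfolding A
    by (rule prod.reindex_bij_witness[of _ Suc "\<lambda>k. k - 1"])
      (auto simp: Suc_diff_le simp flip: Legendre_block)
  also have "\<dots> = (\<Prod>k<l. if odd (l - k) then c k else 1)"
    by (rule prod.inter_filter) simp
  \<comment> \<open>A power of a sign depends only on the parity of the exponent.\<close>
  also have "\<dots> = (\<Prod>k<l. c k ^ (l - k))"
    by (intro prod.cong refl) (use c_cases in \<open>fastforce simp: uminus_power_if\<close>)
  \<comment> \<open>The symbol value 1 excludes both a multiple of p and a nonresidue.\<close>
  finally show ?thesis
    unfolding nonzero_quad_res_def using prod1 by (auto simp: Legendre_def split: if_splits)
qed

end
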